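(* Let $n\ge 2$ and let $L$ be a non-unitary contraction in $\mathfrak{L}_n$. If $V\in\mathcal{B}(\mathcal{K})$ is the minimal isometric dilation of $L$, then $$\dim(\mathcal{K}\ominus V\mathcal{K})=\infty.$$
   Context: Let $\mathcal{F}_n$ be the unital free semigroup on $n$ generators $z_1,\dots,z_n$ (its unit is the empty word $1$), and let $\mathcal{H}_n=\ell_2(\mathcal{F}_n)$, with orthonormal basis $\{\xi_w: w\in\mathcal{F}_n\}$. Let $L_i$ be the isometry on $\mathcal{H}_n$ with $L_i\xi_v=\xi_{z_iv}$. The non-commutative analytic Toeplitz algebra $\mathfrak{L}_n$ is the unital algebra, closed in the weak operator topology, generated by $L_1,\dots,L_n$ in $\mathcal{B}(\mathcal{H}_n)$. The minimal isometric dilation of a contraction $T\in\mathcal{B}(\mathcal{H})$ is the (unique up to unitary equivalence fixing $\mathcal{H}$) isometry $V$ on a Hilbert space $\mathcal{K}\supseteq\mathcal{H}$ such that $T^k=P_{\mathcal{H}}V^k|_{\mathcal{H}}$ for all $k\ge 0$ and $\mathcal{K}$ is the closed linear span of $\bigcup_{k\ge 0}V^k\mathcal{H}$. *)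

theory Defs
  imports "HOL-Analysis.Analysis" "HOL-Library.Extended_Nat"
begin

section \<open>Complex Hilbert spaces\<close>

class complex_vector = real_vector +
  fixes scaleC :: "complex \<Rightarrow> 'a \<Rightarrow> 'a" (infixr \<open>*\<^sub>C\<close> 75)
  assumes scaleC_add_right: "c *\<^sub>C (x + y) = c *\<^sub>C x + c *\<^sub>C y"
    and scaleC_add_left: "(c + d) *\<^sub>C x = c *\<^sub>C x + d *\<^sub>C x"
    and scaleC_scaleC: "c *\<^sub>C (d *\<^sub>C x) = (c * d) *\<^sub>C x"
    and scaleC_one: "1 *\<^sub>C x = x"
    and scaleR_eq_scaleC: "r *\<^sub>R x = complex_of_real r *\<^sub>C x"

global_interpretation complex_vector:
  vector_space "scaleC :: complex \<Rightarrow> 'a \<Rightarrow> 'a :: complex_vector"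
  defines cspan = complex_vector.span
    and cdim = complex_vector.dim
  by unfold_locales (auto simp: scaleC_add_right scaleC_add_left scaleC_scaleC scaleC_one)

text \<open>
  A complex inner product space: \<open>cinner\<close> is linear in the first argument. The class
  \<^class>\<open>real_inner\<close> supplies the underlying real inner product \<open>Re (cinner x y)\<close>, whose positive
  definiteness is that of \<open>cinner\<close>, and with it the norm and the topology.
\<close>

class complex_inner = complex_vector + real_inner +
  fixes cinner :: "'a \<Rightarrow> 'a \<Rightarrow> complex"
  assumes cinner_commute: "cinner x y = cnj (cinner y x)"
    and cinner_add_left: "cinner (x + y) z = cinner x z + cinner y z"
    and cinner_scaleC_left: "cinner (c *\<^sub>C x) y = c * cinner x y"
    and inner_eq_Re_cinner: "inner x y = Re (cinner x y)"

lemma cinner_self: "cinner x x = complex_of_real ((norm x)\<^sup>2)"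
  for x :: "'a::complex_inner"
proof (rule complex_eqI)
  show "Re (cinner x x) = Re (complex_of_real ((norm x)\<^sup>2))"
    by (simp add: power2_norm_eq_inner inner_eq_Re_cinner)
  have "Im (cinner x x) = - Im (cinner x x)"
    by (subst cinner_commute) simp
  then show "Im (cinner x x) = Im (complex_of_real ((norm x)\<^sup>2))" by simp
qed

class chilbert_space = complex_inner + complete_space

definition bounded_clinear :: "('a::complex_inner \<Rightarrow> 'b::complex_inner) \<Rightarrow> bool" where
  "bounded_clinear T \<longleftrightarrow> bounded_linear T \<and> (\<forall>c x. T (c *\<^sub>C x) = c *\<^sub>C T x)"

definition contraction :: "('a::complex_inner \<Rightarrow> 'b::complex_inner) \<Rightarrow> bool" where
  "contraction T \<longleftrightarrow> bounded_clinear T \<and> onorm T \<le> 1"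

definition isometry :: "('a::complex_inner \<Rightarrow> 'b::complex_inner) \<Rightarrow> bool" where
  "isometry V \<longleftrightarrow> bounded_clinear V \<and> (\<forall>x. norm (V x) = norm x)"

definition unitary :: "('a::complex_inner \<Rightarrow> 'b::complex_inner) \<Rightarrow> bool" where
  "unitary U \<longleftrightarrow> isometry U \<and> surj U"

definition orth_minus :: "'a::complex_inner set \<Rightarrow> 'a set \<Rightarrow> 'a set" (infixl \<open>\<ominus>\<close> 65) where
  "M \<ominus> N = {x \<in> M. \<forall>y \<in> N. cinner x y = 0}"

definition orth_proj :: "'a::complex_inner set \<Rightarrow> 'a \<Rightarrow> 'a" where
  "orth_proj M x = (THE p. p \<in> M \<and> x - p \<in> UNIV \<ominus> M)"

text \<open>
  The dimension of a subspace, with a single infinite value. A Hilbert space has finite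
  Hilbert-space dimension iff it has finite algebraic dimension, and then the two agree.
\<close>

definition edim :: "'a::complex_vector set \<Rightarrow> enat" where
  "edim M = (if \<exists>B. finite B \<and> M \<subseteq> cspan B then enat (cdim M) else \<infinity>)"

definition weak_operator_topology :: "('a::complex_inner \<Rightarrow> 'a) topology" where
  "weak_operator_topology =
     topology_generated_by {{T. bounded_clinear T \<and> cinner (T x) y \<in> U} | x y U. open U}"

definition unital_subalgebra :: "('a::complex_inner \<Rightarrow> 'a) set \<Rightarrow> bool" where
  "unital_subalgebra A \<longleftrightarrow>
     (\<forall>T\<in>A. bounded_clinear T) \<and> id \<in> A \<and>
     (\<forall>S\<in>A. \<forall>T\<in>A. (\<lambda>x. S x + T x) \<in> A) \<and>
     (\<forall>c. \<forall>T\<in>A. (\<lambda>x. c *\<^sub>C T x) \<in> A) \<and>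
     (\<forall>S\<in>A. \<forall>T\<in>A. S \<circ> T \<in> A)"

text \<open>
  The inclusion of \<open>H\<close> into \<open>K\<close> is rendered as an isometric embedding \<open>J\<close>; \<open>J\<close> identifies
  \<open>H\<close> with the closed subspace \<open>range J\<close>.
\<close>

definition minimal_isometric_dilation ::
  "('h::chilbert_space \<Rightarrow> 'k::chilbert_space) \<Rightarrow> ('h \<Rightarrow> 'h) \<Rightarrow> ('k \<Rightarrow> 'k) \<Rightarrow> bool" where
  "minimal_isometric_dilation J T V \<longleftrightarrow>
     isometry J \<and> isometry V \<and>
     (\<forall>k x. J ((T ^^ k) x) = orth_proj (range J) ((V ^^ k) (J x))) \<and>
     closure (cspan (\<Union>k. (V ^^ k) ` range J)) = UNIV"


section \<open>Square-summable families\<close>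

typedef 'a ell2 = "{f :: 'a \<Rightarrow> complex. (\<lambda>x. (cmod (f x))\<^sup>2) summable_on UNIV}"
  morphisms coeff Abs_ell2
  by (intro exI[of _ "\<lambda>_. 0"]) simp

setup_lifting type_definition_ell2

lemma coeff_summable: "(\<lambda>x. (cmod (coeff f x))\<^sup>2) summable_on UNIV"
  using coeff by auto

lemma ell2_mult_abs_summable:
  assumes "(\<lambda>x. (cmod (f x))\<^sup>2) summable_on A" "(\<lambda>x. (cmod (g x))\<^sup>2) summable_on A"
  shows "(\<lambda>x. norm (f x * cnj (g x))) summable_on A"
proof (rule summable_on_comparison_test)
  show "(\<lambda>x. (cmod (f x))\<^sup>2 + (cmod (g x))\<^sup>2) summable_on A"
    using assms by (rule summable_on_add)
  show "norm (f x * cnj (g x)) \<le> (cmod (f x))\<^sup>2 + (cmod (g x))\<^sup>2" for x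
    using sum_squares_bound[of "cmod (f x)" "cmod (g x)"]
          mult_nonneg_nonneg[OF norm_ge_zero norm_ge_zero, of "f x" "g x"]
    unfolding norm_mult complex_mod_cnj by linarith
qed auto

lemma coeff_mult_summable: "(\<lambda>x. coeff f x * cnj (coeff g x)) summable_on UNIV"
  by (rule abs_summable_summable, rule ell2_mult_abs_summable) (rule coeff_summable)+

lemma ell2_add_summable:
  assumes "(\<lambda>x. (cmod (f x))\<^sup>2) summable_on A" "(\<lambda>x. (cmod (g x))\<^sup>2) summable_on A"
  shows "(\<lambda>x. (cmod (f x + g x))\<^sup>2) summable_on A"
proof (rule summable_on_comparison_test)
  show "(\<lambda>x. 2 * (cmod (f x))\<^sup>2 + 2 * (cmod (g x))\<^sup>2) summable_on A"
    using assms by (intro summable_on_add summable_on_cmult_right)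
  show "(cmod (f x + g x))\<^sup>2 \<le> 2 * (cmod (f x))\<^sup>2 + 2 * (cmod (g x))\<^sup>2" for x
  proof -
    have "(cmod (f x + g x))\<^sup>2 \<le> (cmod (f x) + cmod (g x))\<^sup>2"
      by (intro power_mono norm_triangle_ineq) auto
    also have "\<dots> \<le> 2 * (cmod (f x))\<^sup>2 + 2 * (cmod (g x))\<^sup>2"
      using sum_squares_bound[of "cmod (f x)" "cmod (g x)"] by (simp add: power2_sum)
    finally show ?thesis .
  qed
qed auto

lemma ell2_cmult_summable:
  "(\<lambda>x. (cmod (f x))\<^sup>2) summable_on A \<Longrightarrow> (\<lambda>x. (cmod (c * f x))\<^sup>2) summable_on A"
  by (simp add: norm_mult power_mult_distrib summable_on_cmult_right)

instantiation ell2 :: (type) complex_inner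
begin

lift_definition zero_ell2 :: "'a ell2" is "\<lambda>_. 0" by simp
lift_definition plus_ell2 :: "'a ell2 \<Rightarrow> 'a ell2 \<Rightarrow> 'a ell2" is "\<lambda>f g x. f x + g x"
  by (rule ell2_add_summable)
lift_definition uminus_ell2 :: "'a ell2 \<Rightarrow> 'a ell2" is "\<lambda>f x. - f x" by simp
lift_definition minus_ell2 :: "'a ell2 \<Rightarrow> 'a ell2 \<Rightarrow> 'a ell2" is "\<lambda>f g x. f x - g x"
  subgoal for f g using ell2_add_summable[of f UNIV "\<lambda>x. - g x"] by simp
  done
lift_definition scaleC_ell2 :: "complex \<Rightarrow> 'a ell2 \<Rightarrow> 'a ell2" is "\<lambda>c f x. c * f x"
  by (rule ell2_cmult_summable)

definition "scaleR_ell2 (r::real) (f :: 'a ell2) = complex_of_real r *\<^sub>C f"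
definition "cinner_ell2 (f :: 'a ell2) g = (\<Sum>\<^sub>\<infinity>x. coeff f x * cnj (coeff g x))"
definition "inner_ell2 (f :: 'a ell2) g = Re (cinner f g)"
definition "norm_ell2 (f :: 'a ell2) = sqrt (inner f f)"
definition "sgn_ell2 (f :: 'a ell2) = inverse (norm f) *\<^sub>R f"
definition "dist_ell2 (f :: 'a ell2) g = norm (f - g)"
definition [code del]:
  "(uniformity :: ('a ell2 \<times> 'a ell2) filter) = (INF e\<in>{0<..}. principal {(x, y). dist x y < e})"
definition [code del]:
  "open (U :: 'a ell2 set) \<longleftrightarrow> (\<forall>x\<in>U. \<forall>\<^sub>F (x', y) in uniformity. x' = x \<longrightarrow> y \<in> U)"

instance
proof
  fix f g h :: "'a ell2" and c d :: complex and r s :: real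
  show "f + g + h = f + (g + h)" "f + g = g + f" "0 + f = f" "- f + f = 0" "f - g = f + - g"
    by (transfer; auto)+
  show add_right: "c *\<^sub>C (f + g) = c *\<^sub>C f + c *\<^sub>C g"
    and add_left: "(c + d) *\<^sub>C f = c *\<^sub>C f + d *\<^sub>C f" for c d :: complex
    by (transfer; auto simp: algebra_simps)+
  show assoc: "c *\<^sub>C d *\<^sub>C f = (c * d) *\<^sub>C f" and one: "1 *\<^sub>C f = f" for c d :: complex
    by (transfer; auto simp: algebra_simps)+
  show "r *\<^sub>R f = complex_of_real r *\<^sub>C f" by (fact scaleR_ell2_def)
  show "r *\<^sub>R (f + g) = r *\<^sub>R f + r *\<^sub>R g" "(r + s) *\<^sub>R f = r *\<^sub>R f + s *\<^sub>R f"
    "r *\<^sub>R s *\<^sub>R f = (r * s) *\<^sub>R f" "1 *\<^sub>R f = f"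
    by (simp_all add: scaleR_ell2_def add_right add_left assoc one)
  show comm: "cinner f g = cnj (cinner g f)" for f g :: "'a ell2"
    unfolding cinner_ell2_def infsum_cnj[symmetric] by (simp add: mult.commute)
  show add: "cinner (f + g) h = cinner f h + cinner g h"
    unfolding cinner_ell2_def plus_ell2.rep_eq distrib_right
    by (intro infsum_add coeff_mult_summable)
  show scale: "cinner (c *\<^sub>C f) g = c * cinner f g" for c
    unfolding cinner_ell2_def scaleC_ell2.rep_eq mult.assoc
    by (intro infsum_cmult_right) (use coeff_mult_summable in blast)
  show "inner f g = Re (cinner f g)" by (fact inner_ell2_def)
  show "inner f g = inner g f"
    unfolding inner_ell2_def by (subst comm) simp
  show "inner (f + g) h = inner f h + inner g h"
    unfolding inner_ell2_def add by simp
  show "inner (r *\<^sub>R f) g = r * inner f g"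
    unfolding inner_ell2_def scaleR_ell2_def scale by simp
  have self: "inner f f = (\<Sum>\<^sub>\<infinity>x. (cmod (coeff f x))\<^sup>2)"
    unfolding inner_ell2_def cinner_ell2_def
    by (subst infsum_Re[symmetric], rule coeff_mult_summable)
       (simp flip: complex_norm_square add: complex_mult_cnj cmod_power2)
  show "0 \<le> inner f f" unfolding self by (rule infsum_nonneg) simp
  show "inner f f = 0 \<longleftrightarrow> f = 0"
  proof
    assume "inner f f = 0"
    then have z: "(\<Sum>\<^sub>\<infinity>x. (cmod (coeff f x))\<^sup>2) = 0" using self by simp
    have "coeff f x = 0" for x
      using finite_sum_le_infsum[OF coeff_summable[of f], of "{x}"] z by simp
    then show "f = 0" by transfer auto
  next
    assume "f = 0"
    then show "inner f f = 0" unfolding self by (simp add: zero_ell2.rep_eq)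
  qed
  show "norm f = sqrt (inner f f)" by (fact norm_ell2_def)
  show "sgn f = inverse (norm f) *\<^sub>R f" by (fact sgn_ell2_def)
  show "dist f g = norm (f - g)" by (fact dist_ell2_def)
  show "(uniformity :: ('a ell2 \<times> 'a ell2) filter) =
      (INF e\<in>{0<..}. principal {(x, y). dist x y < e})" by (fact uniformity_ell2_def)
  show "open U \<longleftrightarrow> (\<forall>x\<in>U. \<forall>\<^sub>F (x', y) in uniformity. x' = x \<longrightarrow> y \<in> U)" for U :: "'a ell2 set"
    by (fact open_ell2_def)
qed

end

lemma norm_ell2_sq: "(norm f)\<^sup>2 = (\<Sum>\<^sub>\<infinity>x. (cmod (coeff f x))\<^sup>2)"
proof -
  have "(norm f)\<^sup>2 = Re (\<Sum>\<^sub>\<infinity>x. coeff f x * cnj (coeff f x))"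
    by (simp add: power2_norm_eq_inner inner_eq_Re_cinner cinner_ell2_def)
  also have "\<dots> = (\<Sum>\<^sub>\<infinity>x. (cmod (coeff f x))\<^sup>2)"
    by (subst infsum_Re[symmetric], rule coeff_mult_summable)
       (simp flip: complex_norm_square add: complex_mult_cnj cmod_power2)
  finally show ?thesis .
qed

lemma sum_coeff_le_norm: "finite F \<Longrightarrow> (\<Sum>x\<in>F. (cmod (coeff f x))\<^sup>2) \<le> (norm f)\<^sup>2"
  unfolding norm_ell2_sq by (rule finite_sum_le_infsum[OF coeff_summable]) auto

lemma cmod_coeff_le_norm: "cmod (coeff f x) \<le> norm f"
  using sum_coeff_le_norm[of "{x}" f] by (simp add: abs_le_square_iff[symmetric])

instance ell2 :: (type) chilbert_space
proof
  fix X :: "nat \<Rightarrow> 'a ell2" assume "Cauchy X"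
  define g where "g x = lim (\<lambda>n. coeff (X n) x)" for x
  have g: "(\<lambda>n. coeff (X n) x) \<longlonglongrightarrow> g x" for x
  proof -
    have "Cauchy (\<lambda>n. coeff (X n) x)"
    proof (rule metric_CauchyI)
      fix e :: real assume "e > 0"
      then obtain N where N: "\<And>m n. m \<ge> N \<Longrightarrow> n \<ge> N \<Longrightarrow> dist (X m) (X n) < e"
        using metric_CauchyD[OF \<open>Cauchy X\<close>] by blast
      have "dist (coeff (X m) x) (coeff (X n) x) < e" if "m \<ge> N" "n \<ge> N" for m n
        using cmod_coeff_le_norm[of "X m - X n" x] N[OF that]
        by (simp add: dist_norm minus_ell2.rep_eq)
      then show "\<exists>N. \<forall>m\<ge>N. \<forall>n\<ge>N. dist (coeff (X m) x) (coeff (X n) x) < e" by blast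
    qed
    then show ?thesis
      unfolding g_def by (simp add: Cauchy_convergent_iff convergent_LIMSEQ_iff)
  qed
  have bound: "(\<Sum>x\<in>F. (cmod (coeff (X n) x - g x))\<^sup>2) \<le> e\<^sup>2"
    if N: "\<And>m n. m \<ge> N \<Longrightarrow> n \<ge> N \<Longrightarrow> dist (X m) (X n) < e" and "n \<ge> N" "finite F"
    for e N n F
  proof (rule tendsto_upperbound)
    show "(\<lambda>m. \<Sum>x\<in>F. (cmod (coeff (X n) x - coeff (X m) x))\<^sup>2)
        \<longlonglongrightarrow> (\<Sum>x\<in>F. (cmod (coeff (X n) x - g x))\<^sup>2)"
      by (intro tendsto_intros g)
    have "(\<Sum>x\<in>F. (cmod (coeff (X n) x - coeff (X m) x))\<^sup>2) \<le> e\<^sup>2" if "m \<ge> N" for m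
    proof -
      have "(\<Sum>x\<in>F. (cmod (coeff (X n) x - coeff (X m) x))\<^sup>2) \<le> (norm (X n - X m))\<^sup>2"
        using sum_coeff_le_norm[OF \<open>finite F\<close>, of "X n - X m"] by (simp add: minus_ell2.rep_eq)
      also have "\<dots> \<le> e\<^sup>2"
        using N[OF \<open>n \<ge> N\<close> that] by (intro power_mono) (auto simp: dist_norm)
      finally show ?thesis .
    qed
    then show "\<forall>\<^sub>F m in sequentially.
        (\<Sum>x\<in>F. (cmod (coeff (X n) x - coeff (X m) x))\<^sup>2) \<le> e\<^sup>2"
      using eventually_sequentially by blast
  qed simp
  have summ: "(\<lambda>x. (cmod (coeff (X n) x - g x))\<^sup>2) summable_on UNIV"
    if N: "\<And>m n. m \<ge> N \<Longrightarrow> n \<ge> N \<Longrightarrow> dist (X m) (X n) < e" and "n \<ge> N" for e N n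
    by (rule nonneg_bdd_above_summable_on) (auto intro!: bdd_aboveI2 bound[OF N \<open>n \<ge> N\<close>])
  obtain N1 where N1: "\<And>m n. m \<ge> N1 \<Longrightarrow> n \<ge> N1 \<Longrightarrow> dist (X m) (X n) < 1"
    using metric_CauchyD[OF \<open>Cauchy X\<close>, of 1] by auto
  have "(\<lambda>x. (cmod (coeff (X N1) x + - (coeff (X N1) x - g x)))\<^sup>2) summable_on UNIV"
    by (rule ell2_add_summable[OF coeff_summable], subst norm_minus_cancel)
       (rule summ[OF N1 order_refl])
  then have Y: "coeff (Abs_ell2 g) = g" by (simp add: Abs_ell2_inverse)
  have "X \<longlonglongrightarrow> Abs_ell2 g"
  proof (rule metric_LIMSEQ_I)
    fix e :: real assume "e > 0"
    then obtain N where N: "\<And>m n. m \<ge> N \<Longrightarrow> n \<ge> N \<Longrightarrow> dist (X m) (X n) < e/2"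
      using metric_CauchyD[OF \<open>Cauchy X\<close>, of "e/2"] by auto
    have "dist (X n) (Abs_ell2 g) < e" if "n \<ge> N" for n
    proof -
      have "(norm (X n - Abs_ell2 g))\<^sup>2 \<le> (e/2)\<^sup>2"
        unfolding norm_ell2_sq minus_ell2.rep_eq Y
        by (rule infsum_le_finite_sums[OF summ[OF N that]]) (auto intro!: bound[OF N that])
      then have "norm (X n - Abs_ell2 g) \<le> e/2"
        by (rule power2_le_imp_le) (use \<open>e > 0\<close> in auto)
      then show ?thesis using \<open>e > 0\<close> by (simp add: dist_norm)
    qed
    then show "\<exists>N. \<forall>n\<ge>N. dist (X n) (Abs_ell2 g) < e" by blast
  qed
  then show "convergent X" by (auto simp: convergent_def)
qed

lift_definition basis_vec :: "'a \<Rightarrow> 'a ell2" (\<open>\<xi>\<close>) is "\<lambda>w v. if v = w then 1 else 0"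
  by (rule finite_nonzero_values_imp_summable_on) (auto simp: if_distrib cong: if_cong)


section \<open>The non-commutative analytic Toeplitz algebra\<close>

text \<open>
  The free semigroup on the generators \<open>'n\<close> is \<open>'n list\<close> under concatenation, with the empty
  word as unit. The coefficient of \<open>L\<^sub>i f\<close> at \<open>z\<^sub>i v\<close> is that of \<open>f\<close> at \<open>v\<close>, and it is \<open>0\<close> at
  all words that do not start with \<open>z\<^sub>i\<close>.
\<close>

lift_definition left_creation :: "'n \<Rightarrow> 'n list ell2 \<Rightarrow> 'n list ell2" is
  "\<lambda>i f w. case w of [] \<Rightarrow> 0 | j # v \<Rightarrow> if j = i then f v else 0"
  subgoal for i f
  proof -
    assume "(\<lambda>x. (cmod (f x))\<^sup>2) summable_on UNIV"
    then have "(\<lambda>w. (cmod (case w of [] \<Rightarrow> 0 | j # v \<Rightarrow> if j = i then f v else 0))\<^sup>2)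
        summable_on range ((#) i)"
      by (subst summable_on_reindex) (auto simp: o_def)
    then show ?thesis
      by (rule summable_on_cong_neutral[THEN iffD1, rotated -1])
         (auto split: list.splits if_splits)
  qed
  done

lemma left_creation_basis_vec: "left_creation i (\<xi> v) = \<xi> (i # v)"
  by transfer (auto simp: fun_eq_iff split: list.splits)

lemma norm_left_creation: "norm (left_creation i f) = norm f"
proof -
  have "(\<Sum>\<^sub>\<infinity>w. (cmod (coeff (left_creation i f) w))\<^sup>2) =
      (\<Sum>\<^sub>\<infinity>w\<in>range ((#) i). (cmod (coeff (left_creation i f) w))\<^sup>2)"
    by (rule infsum_cong_neutral) (auto simp: left_creation.rep_eq split: list.splits if_splits)
  also have "\<dots> = (\<Sum>\<^sub>\<infinity>v. (cmod (coeff f v))\<^sup>2)"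
    by (subst infsum_reindex) (auto simp: o_def left_creation.rep_eq)
  finally have "(norm (left_creation i f))\<^sup>2 = (norm f)\<^sup>2"
    unfolding norm_ell2_sq .
  then show ?thesis by (simp add: power2_eq_iff_nonneg)
qed

lemma isometry_left_creation: "isometry (left_creation i)"
proof -
  have scale: "left_creation i (c *\<^sub>C f) = c *\<^sub>C left_creation i f" for c f
    by transfer (auto simp: fun_eq_iff split: list.splits)
  have "bounded_linear (left_creation i)"
  proof (rule bounded_linear_intro)
    show "left_creation i (f + g) = left_creation i f + left_creation i g" for f g
      by transfer (auto simp: fun_eq_iff split: list.splits)
    show "left_creation i (r *\<^sub>R f) = r *\<^sub>R left_creation i f" for r f
      by (simp add: scaleR_eq_scaleC scale)
    show "norm (left_creation i f) \<le> norm f * 1" for f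
      by (simp add: norm_left_creation)
  qed
  then show ?thesis
    by (simp add: isometry_def bounded_clinear_def scale norm_left_creation)
qed

definition nc_toeplitz_algebra :: "('n list ell2 \<Rightarrow> 'n list ell2) set" where
  "nc_toeplitz_algebra =
     \<Inter> {A. unital_subalgebra A \<and> closedin weak_operator_topology A \<and> range left_creation \<subseteq> A}"

end

theory Submission
  imports Defs
begin

text \<open>
  Put \<open>\<eta> = L \<xi>\<^sub>1\<close>, where \<open>1\<close> is the empty word, and let \<open>\<eta>\<^sub>u\<close> be its coefficient at \<open>u\<close>. Since \<open>L\<close>
  commutes with right multiplication by words, \<open>\<eta>\<close> determines it: \<open>L \<xi>\<^sub>v\<close> is \<open>\<eta>\<close> with every word
  \<open>u\<close> moved to \<open>u v\<close>. Reading this matrix along its rows, \<open>L\<^sup>* \<xi>\<^sub>w\<close> is a finite sum over the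
  factorizations \<open>w = u v\<close>, and its squared norm is the sum of \<open>\<bar>\<eta>\<^sub>u\<bar>\<^sup>2\<close> over the prefixes \<open>u\<close>
  of \<open>w\<close> (\<open>norm_adjoint_basis_vec\<close>).

  On the other side, let \<open>P\<close> be the projection of the dilation space to the orthogonal complement
  of the range of \<open>V\<close>. By minimality \<open>V\<^sup>* J x = J L\<^sup>* x\<close>, so that
  \<open>P J \<xi>\<^sub>w = J \<xi>\<^sub>w - V J L\<^sup>* \<xi>\<^sub>w\<close> has squared norm \<open>1\<close> minus the sum of \<open>\<bar>\<eta>\<^sub>u\<bar>\<^sup>2\<close> over the
  prefixes of \<open>w\<close> (\<open>defect_vector\<close>). If the complement had finite dimension, these projections
  would tend to \<open>0\<close> along every sequence of distinct words, as the vectors \<open>J \<xi>\<^sub>w\<close> are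
  orthonormal (\<open>finite_dim_projection_tendsto_0\<close>). For distinct generators \<open>a\<close> and \<open>b\<close>, the
  powers of \<open>a\<close> would therefore carry squared norm \<open>1\<close> of \<open>\<eta>\<close>, and so would the powers of \<open>b\<close>.
  These two sets of words share only the empty word, and \<open>\<eta>\<close> has norm at most \<open>1\<close>. Hence all
  the norm sits at the empty word, \<open>\<eta>\<close> is a unimodular multiple \<open>c \<xi>\<^sub>1\<close>, and \<open>L = c I\<close> is
  unitary.
\<close>

section \<open>Inner products\<close>

lemma cinner_scaleC_right: "cinner x (c *\<^sub>C y) = cnj c * cinner x y"
  by (subst (1 2) cinner_commute) (simp add: cinner_scaleC_left)

text \<open>
  Orthogonality to a set closed under complex scalars can be tested with the real inner product,
  which most of the arguments below use.
\<close>

lemma cinner_eq_0I: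
  assumes "\<And>c. inner x (c *\<^sub>C y) = 0"
  shows "cinner x y = 0"
proof (rule complex_eqI)
  show "Re (cinner x y) = Re 0"
    using assms[of 1] by (simp add: inner_eq_Re_cinner scaleC_one)
  \<comment> \<open>The real part of \<open>cinner x (\<i> *\<^sub>C y)\<close> is the imaginary part of \<open>cinner x y\<close>.\<close>
  show "Im (cinner x y) = Im 0"
    using assms[of \<i>] by (simp add: inner_eq_Re_cinner cinner_scaleC_right)
qed

lemma inner_linear_isometry:
  assumes "linear f" "\<And>x. norm (f x) = norm x"
  shows "inner (f x) (f y) = inner x y"
proof -
  have "inner (f x) (f y) = ((norm (f (x + y)))\<^sup>2 - (norm (f x))\<^sup>2 - (norm (f y))\<^sup>2) / 2"
    by (simp add: linear_add[OF assms(1)] power2_norm_eq_inner inner_commute algebra_simps)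
  also have "\<dots> = inner x y"
    by (simp add: assms(2) power2_norm_eq_inner inner_commute algebra_simps)
  finally show ?thesis .
qed

lemma isometry_inner: "isometry U \<Longrightarrow> inner (U x) (U y) = inner x y"
  by (rule inner_linear_isometry)
     (auto simp: isometry_def bounded_clinear_def bounded_linear.linear)

text \<open>
  A minimizing sequence for the distance is Cauchy by the parallelogram law; its limit is the
  foot of the perpendicular.
\<close>

lemma closed_subspace_projection:
  fixes S :: "'a::{real_inner, complete_space} set"
  assumes "closed S" "subspace S"
  obtains p where "p \<in> S" "\<And>y. y \<in> S \<Longrightarrow> inner (x - p) y = 0"
proof -
  have ne: "S \<noteq> {}" using subspace_0[OF assms(2)] by blast
  define d where "d = infdist x S"
  have d0: "d \<ge> 0" by (simp add: d_def infdist_nonneg)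
  have dle: "d \<le> norm (x - s)" if "s \<in> S" for s
    using infdist_le[OF that, of x] by (simp add: d_def dist_norm)
  have "\<exists>s\<in>S. norm (x - s) < d + 1 / real (Suc n)" for n
  proof -
    have "Inf (dist x ` S) < d + 1 / real (Suc n)"
      using ne by (simp add: d_def infdist_def)
    then show ?thesis
      using cInf_lessD[of "dist x ` S" "d + 1 / real (Suc n)"] ne by (auto simp: dist_norm)
  qed
  then obtain s where s: "\<And>n. s n \<in> S" "\<And>n. norm (x - s n) < d + 1 / real (Suc n)"
    by metis
  have lim: "(\<lambda>n. d + 1 / real (Suc n)) \<longlonglongrightarrow> d"
    using tendsto_add[OF tendsto_const[of d] LIMSEQ_inverse_real_of_nat]
    by (simp add: inverse_eq_divide)
  have "Cauchy s"
  proof (rule metric_CauchyI)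
    fix e :: real assume "e > 0"
    \<comment> \<open>By the parallelogram law, \<open>4 * (r\<^sup>2 - d\<^sup>2)\<close> bounds the squared distance of two points of \<open>S\<close>
      at distance at most \<open>r\<close> from \<open>x\<close>, as their midpoint is at distance at least \<open>d\<close>.\<close>
    have "(\<lambda>n. 4 * ((d + 1 / real (Suc n))\<^sup>2 - d\<^sup>2)) \<longlonglongrightarrow> 4 * (d\<^sup>2 - d\<^sup>2)"
      by (intro tendsto_intros lim)
    then have "\<forall>\<^sub>F n in sequentially. 4 * ((d + 1 / real (Suc n))\<^sup>2 - d\<^sup>2) < e\<^sup>2"
      by (rule order_tendstoD(2)) (use \<open>e > 0\<close> in simp)
    then obtain N where N: "4 * ((d + 1 / real (Suc N))\<^sup>2 - d\<^sup>2) < e\<^sup>2"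
      using eventually_sequentially by auto
    have near: "(norm (x - s n))\<^sup>2 \<le> (d + 1 / real (Suc N))\<^sup>2" if "n \<ge> N" for n
    proof (rule power_mono)
      have "1 / real (Suc n) \<le> 1 / real (Suc N)"
        using that by (simp add: frac_le)
      then show "norm (x - s n) \<le> d + 1 / real (Suc N)"
        using s(2)[of n] by linarith
    qed simp
    have "dist (s m) (s n) < e" if "m \<ge> N" "n \<ge> N" for m n
    proof -
      define c where "c = (1/2) *\<^sub>R (s m + s n)"
      have "c \<in> S"
        unfolding c_def using assms(2) s(1) by (intro subspace_scale subspace_add) auto
      then have "d\<^sup>2 \<le> (norm (x - c))\<^sup>2"
        using dle d0 by (intro power_mono) auto
      moreover have "(norm (s m - s n))\<^sup>2 =
          2 * (norm (x - s m))\<^sup>2 + 2 * (norm (x - s n))\<^sup>2 - 4 * (norm (x - c))\<^sup>2"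
        unfolding power2_norm_eq_inner c_def
        by (simp add: inner_diff inner_add inner_commute algebra_simps)
      ultimately have "(norm (s m - s n))\<^sup>2 < e\<^sup>2"
        using near[OF that(1)] near[OF that(2)] N unfolding right_diff_distrib by linarith
      then show ?thesis
        using \<open>e > 0\<close> by (simp add: dist_norm power_less_imp_less_base)
    qed
    then show "\<exists>N. \<forall>m\<ge>N. \<forall>n\<ge>N. dist (s m) (s n) < e" by blast
  qed
  then obtain p where p: "s \<longlonglongrightarrow> p"
    using Cauchy_convergent_iff convergent_def by blast
  have "p \<in> S"
    using closed_sequentially[OF assms(1)] s(1) p by blast
  have "norm (x - p) \<le> d"
    by (rule LIMSEQ_le[OF tendsto_norm[OF tendsto_diff[OF tendsto_const p]] lim])
       (use s(2) less_imp_le in blast)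
  then have closest: "\<forall>z\<in>S. dist x p \<le> dist x z"
    using dle by (fastforce simp: dist_norm)
  have half: "inner (x - p) y \<le> 0" if "y \<in> S" for y
    using any_closest_point_dot[OF subspace_imp_convex[OF assms(2)] assms(1) \<open>p \<in> S\<close> _ closest,
        of "p + y"] subspace_add[OF assms(2) \<open>p \<in> S\<close> that] by simp
  have "inner (x - p) y = 0" if "y \<in> S" for y
    using half[OF that] half[OF subspace_neg[OF assms(2) that]] by simp
  with \<open>p \<in> S\<close> show ?thesis by (rule that)
qed

text \<open>
  Closedness of \<open>M\<close> provides the vector that the definite description in \<^const>\<open>orth_proj\<close> asks for.
\<close>

lemma orth_proj_orthogonal:
  fixes M :: "'a::chilbert_space set"
  assumes "closed M" "subspace M" and scale: "\<And>c y. y \<in> M \<Longrightarrow> c *\<^sub>C y \<in> M" and "y \<in> M"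
  shows "inner (orth_proj M x) y = inner x y"
proof -
  obtain p where p: "p \<in> M" "\<And>y. y \<in> M \<Longrightarrow> inner (x - p) y = 0"
    using closed_subspace_projection[OF assms(1,2), of x] by blast
  have "orth_proj M x = p"
    unfolding orth_proj_def
  proof (rule the_equality)
    show "p \<in> M \<and> x - p \<in> UNIV \<ominus> M"
      using p scale by (auto simp: orth_minus_def intro!: cinner_eq_0I)
    fix q assume q: "q \<in> M \<and> x - q \<in> UNIV \<ominus> M"
    have "q - p \<in> M" using p q assms(2) by (simp add: subspace_diff)
    then have "inner (x - p) (q - p) = 0" "inner (x - q) (q - p) = 0"
      using p q by (auto simp: orth_minus_def inner_eq_Re_cinner)
    then have "inner (q - p) (q - p) = 0" by (simp add: inner_diff)
    then show "q = p" by simp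
  qed
  then show ?thesis using p(2)[OF assms(4)] by (simp add: inner_diff)
qed

lemma Bessel_inequality:
  fixes u :: "'i \<Rightarrow> 'a::real_inner"
  assumes "finite I" and on: "\<And>i j. inner (u i) (u j) = (if i = j then 1 else 0)"
  shows "(\<Sum>i\<in>I. (inner (u i) y)\<^sup>2) \<le> (norm y)\<^sup>2"
proof -
  define p where "p = (\<Sum>i\<in>I. inner (u i) y *\<^sub>R u i)"
  have yp: "inner p y = (\<Sum>i\<in>I. (inner (u i) y)\<^sup>2)"
    by (simp add: p_def inner_sum_left power2_eq_square)
  have "inner (u i) p = inner (u i) y" if "i \<in> I" for i
    using that assms(1) by (simp add: p_def inner_sum_right on if_distrib cong: if_cong)
  then have pp: "inner p p = (\<Sum>i\<in>I. (inner (u i) y)\<^sup>2)"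
    by (subst p_def) (simp add: inner_sum_left power2_eq_square)
  have "0 \<le> inner (y - p) (y - p)" by simp
  then show ?thesis
    by (simp add: inner_diff power2_norm_eq_inner yp pp inner_commute[of y p])
qed

text \<open>
  An orthonormal sequence tends weakly to \<open>0\<close>, so its projections \<open>e\<close> to a finite-dimensional
  space tend to \<open>0\<close> in norm.
\<close>

lemma finite_dim_projection_tendsto_0:
  fixes u e :: "nat \<Rightarrow> 'a::real_inner"
  assumes "finite B" "W \<subseteq> span B" "subspace W"
    and on: "\<And>i j. inner (u i) (u j) = (if i = j then 1 else 0)"
    and e: "\<And>i. e i \<in> W" "\<And>i y. y \<in> W \<Longrightarrow> inner (e i) y = inner (u i) y"
  shows "(\<lambda>i. (norm (e i))\<^sup>2) \<longlonglongrightarrow> 0"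
proof -
  obtain A where A: "A \<subseteq> W" "independent A" "W \<subseteq> span A"
    by (rule basis_exists[of W]) auto
  have "finite A"
    using independent_span_bound[OF assms(1) A(2)] A(1) assms(2) by blast
  then obtain C where C: "finite C" "span C = span A" "pairwise orthogonal C"
    using basis_orthogonal by blast
  have CW: "C \<subseteq> W"
    using span_superset[of C] span_minimal[OF A(1) assms(3)] C(2) by auto
  have expand: "(norm x)\<^sup>2 = (\<Sum>c\<in>C. (inner x c)\<^sup>2 / (norm c)\<^sup>2)" if "x \<in> W" for x
  proof -
    have "x \<in> span C" using that A(3) C(2) by auto
    then obtain a where a: "x = (\<Sum>c\<in>C. a c *\<^sub>R c)"
      unfolding span_finite[OF C(1)] by blast
    have xc: "inner x c = a c * (norm c)\<^sup>2" if "c \<in> C" for c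
    proof -
      have "inner x c = (\<Sum>d\<in>C. if d = c then a c * (norm c)\<^sup>2 else 0)"
        unfolding a inner_sum_left
        by (rule sum.cong)
           (use C(3) that in \<open>auto simp: pairwise_def orthogonal_def power2_norm_eq_inner\<close>)
      then show ?thesis using that C(1) by simp
    qed
    have "(norm x)\<^sup>2 = (\<Sum>c\<in>C. a c * inner x c)"
      unfolding power2_norm_eq_inner by (subst (2) a) (simp add: inner_sum_right)
    also have "\<dots> = (\<Sum>c\<in>C. (inner x c)\<^sup>2 / (norm c)\<^sup>2)"
      by (rule sum.cong) (auto simp: xc power2_eq_square)
    finally show ?thesis .
  qed
  have weak: "(\<lambda>i. (inner (u i) c)\<^sup>2) \<longlonglongrightarrow> 0" for c
  proof (rule summable_LIMSEQ_zero, rule summableI_nonneg_bounded)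
    show "(\<Sum>i<n. (inner (u i) c)\<^sup>2) \<le> (norm c)\<^sup>2" for n
      by (rule Bessel_inequality) (simp_all add: on)
  qed simp
  have "(\<lambda>i. \<Sum>c\<in>C. (inner (u i) c)\<^sup>2 / (norm c)\<^sup>2) \<longlonglongrightarrow> (\<Sum>c\<in>C. 0 / (norm c)\<^sup>2)"
    unfolding divide_inverse by (intro tendsto_sum tendsto_mult_right weak)
  moreover have "(\<Sum>c\<in>C. (inner (u i) c)\<^sup>2 / (norm c)\<^sup>2) = (norm (e i))\<^sup>2" for i
    unfolding expand[OF e(1)] using CW e(2) by (intro sum.cong) auto
  ultimately show ?thesis by simp
qed

lemma finite_edim_real_span:
  assumes "edim M \<noteq> \<infinity>"
  obtains B where "finite B" "M \<subseteq> span B"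
proof -
  obtain A where A: "finite A" "M \<subseteq> cspan A"
    using assms by (auto simp: edim_def split: if_splits)
  \<comment> \<open>Multiplying by \<open>\<i>\<close> supplies the imaginary parts of the complex coefficients.\<close>
  let ?B = "A \<union> (\<lambda>x. \<i> *\<^sub>C x) ` A"
  have "cspan A \<subseteq> span ?B"
  proof
    fix x assume "x \<in> cspan A"
    then obtain r where x: "x = (\<Sum>a\<in>A. r a *\<^sub>C a)"
      unfolding complex_vector.span_finite[OF A(1)] by blast
    have "r a *\<^sub>C a = Re (r a) *\<^sub>R a + Im (r a) *\<^sub>R (\<i> *\<^sub>C a)" for a
      unfolding scaleR_eq_scaleC scaleC_scaleC scaleC_add_left[symmetric]
      by (subst complex_eq[of "r a"]) (simp add: mult.commute)
    then have "r a *\<^sub>C a \<in> span ?B" if "a \<in> A" for a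
      using that by (metis UnCI imageI span_add span_base span_scale)
    then show "x \<in> span ?B"
      unfolding x by (rule span_sum)
  qed
  with A show ?thesis by (intro that[of ?B]) auto
qed

section \<open>Defect vectors of an isometric dilation\<close>

lemma isometric_dilation_inner:
  assumes "minimal_isometric_dilation J T V"
  shows "inner ((V ^^ k) (J x)) (J y) = inner ((T ^^ k) x) y"
proof -
  have J: "isometry J"
    and proj: "J ((T ^^ k) x) = orth_proj (range J) ((V ^^ k) (J x))"
    using assms by (auto simp: minimal_isometric_dilation_def)
  have bl: "bounded_linear J" and sc: "\<And>c x. J (c *\<^sub>C x) = c *\<^sub>C J x"
    and nm: "\<And>x. norm (J x) = norm x"
    using J by (auto simp: isometry_def bounded_clinear_def)
  have sub: "subspace (range J)"
    by (intro linear_subspace_image bounded_linear.linear[OF bl] subspace_UNIV)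
  have "complete (range J)"
    by (rule complete_isometric_image[of 1, OF _ subspace_UNIV bl]) (auto simp: nm complete_UNIV)
  then have "closed (range J)" by (rule complete_imp_closed)
  then have "inner ((V ^^ k) (J x)) (J y) = inner (J ((T ^^ k) x)) (J y)"
    unfolding proj using sub
    by (subst orth_proj_orthogonal) (auto simp flip: sc)
  then show ?thesis by (simp add: isometry_inner[OF J])
qed

text \<open>
  The hypothesis on \<open>g\<close> says that \<open>g = T\<^sup>* x\<close>. Pairing with the vectors \<open>V\<^sup>k J h\<close>, which span a
  dense subspace by minimality, shows \<open>V\<^sup>* J x = J g\<close>. So \<open>J x - V (J g)\<close> is the projection of
  \<open>J x\<close> to the complement of the range of \<open>V\<close>, and its squared norm is
  \<open>\<langle>(I - T T\<^sup>*) x, x\<rangle>\<close>.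
\<close>

lemma defect_vector:
  assumes dil: "minimal_isometric_dilation J T V"
    and g: "\<And>h. inner g h = inner x (T h)"
  shows "J x - V (J g) \<in> UNIV \<ominus> range V"
    and "(norm (J x - V (J g)))\<^sup>2 = (norm x)\<^sup>2 - (norm g)\<^sup>2"
proof -
  let ?e = "J x - V (J g)"
  have J: "isometry J" and V: "isometry V"
    and dense: "closure (cspan (\<Union>k. (V ^^ k) ` range J)) = UNIV"
    using dil by (auto simp: minimal_isometric_dilation_def)
  have blV: "bounded_linear V" and scV: "\<And>c x. V (c *\<^sub>C x) = c *\<^sub>C V x"
    and scJ: "\<And>c x. J (c *\<^sub>C x) = c *\<^sub>C J x"
    using J V by (auto simp: isometry_def bounded_clinear_def)
  have sck: "(V ^^ k) (c *\<^sub>C y) = c *\<^sub>C (V ^^ k) y" for k c y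
    by (induction k) (simp_all add: scV)
  have gen: "inner ?e (V ((V ^^ k) (J h))) = 0" for k h
  proof -
    have "inner (J x) ((V ^^ Suc k) (J h)) = inner x ((T ^^ Suc k) h)"
      using isometric_dilation_inner[OF dil, of "Suc k" h x] by (simp only: inner_commute)
    moreover have "inner (J g) ((V ^^ k) (J h)) = inner g ((T ^^ k) h)"
      using isometric_dilation_inner[OF dil, of k h g] by (simp only: inner_commute)
    ultimately show ?thesis
      by (simp add: inner_diff_left isometry_inner[OF V] g)
  qed
  \<comment> \<open>The scalar \<open>c\<close> makes the claim stable under complex linear combinations.\<close>
  have "\<forall>c. inner ?e (V (c *\<^sub>C y)) = 0" if "y \<in> cspan (\<Union>k. (V ^^ k) ` range J)" for y
    using that
  proof (induction rule: complex_vector.span_induct_alt)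
    case base
    have "c *\<^sub>C (0::'b) = 0" for c
      using scaleC_add_right[of c "0::'b" 0] by simp
    then show ?case by (simp add: linear_0[OF bounded_linear.linear[OF blV]])
  next
    case (step c y z)
    then obtain k h where "y = (V ^^ k) (J h)" by auto
    then have "V (d *\<^sub>C c *\<^sub>C y) = V ((V ^^ k) (J ((d * c) *\<^sub>C h)))" for d
      by (simp add: scJ sck scaleC_scaleC)
    then show ?case
      using step gen
      by (simp add: scaleC_add_right linear_add[OF bounded_linear.linear[OF blV]] inner_add_right)
  qed
  from this[THEN spec[of _ 1]]
  have "cspan (\<Union>k. (V ^^ k) ` range J) \<subseteq> {y. inner ?e (V y) = 0}"
    by (auto simp: scaleC_one)
  moreover have "closed {y. inner ?e (V y) = 0}"
    by (intro closed_Collect_eq continuous_intros linear_continuous_on blV)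
  ultimately have orth: "inner ?e (V y) = 0" for y
    using dense closure_minimal by blast
  then show "?e \<in> UNIV \<ominus> range V"
    by (auto simp: orth_minus_def intro!: cinner_eq_0I simp flip: scV)
  have "inner (V (J g)) (J x) = inner g g"
    using isometric_dilation_inner[OF dil, of 1 g x] g[of g] by (simp add: inner_commute)
  then show "(norm ?e)\<^sup>2 = (norm x)\<^sup>2 - (norm g)\<^sup>2"
    by (simp add: power2_norm_eq_inner inner_diff isometry_inner[OF V] isometry_inner[OF J]
        inner_commute)
qed

section \<open>Expansion in the standard basis\<close>

lemma coeff_basis_vec: "coeff (\<xi> w) v = (if v = w then 1 else 0)"
  by transfer simp

lemma cinner_basis_vec: "cinner f (\<xi> w) = coeff f w"
proof -
  have "cinner f (\<xi> w) = (\<Sum>\<^sub>\<infinity>x\<in>{w}. coeff f x * cnj (coeff (\<xi> w) x))"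
    unfolding cinner_ell2_def by (rule infsum_cong_neutral) (auto simp: coeff_basis_vec)
  then show ?thesis by (simp add: coeff_basis_vec)
qed

lemma inner_basis_vec: "inner f (\<xi> w) = Re (coeff f w)"
  by (simp add: inner_eq_Re_cinner cinner_basis_vec)

lemma coeff_sum: "coeff (sum f A) w = (\<Sum>a\<in>A. coeff (f a) w)"
  by (induction A rule: infinite_finite_induct) (simp_all add: zero_ell2.rep_eq plus_ell2.rep_eq)

lemma has_sum_basis_expansion: "((\<lambda>w. coeff f w *\<^sub>C \<xi> w) has_sum f) UNIV"
proof -
  let ?p = "\<lambda>F. \<Sum>w\<in>F. coeff f w *\<^sub>C \<xi> w"
  let ?s = "\<lambda>w. (cmod (coeff f w))\<^sup>2"
  have rest: "(norm (?p F - f))\<^sup>2 = infsum ?s UNIV - sum ?s F" if "finite F" for F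
  proof -
    have "coeff (?p F) w = (if w \<in> F then coeff f w else 0)" for w
      using that
      by (simp add: coeff_sum scaleC_ell2.rep_eq coeff_basis_vec if_distrib cong: if_cong)
    then have "(norm (?p F - f))\<^sup>2 = (\<Sum>\<^sub>\<infinity>w\<in>UNIV - F. ?s w)"
      unfolding norm_ell2_sq by (intro infsum_cong_neutral) (auto simp: minus_ell2.rep_eq)
    also have "\<dots> = infsum ?s UNIV - infsum ?s F"
      using that by (intro infsum_Diff coeff_summable) auto
    finally show ?thesis using that by simp
  qed
  have "((\<lambda>F. infsum ?s UNIV - sum ?s F) \<longlongrightarrow> infsum ?s UNIV - infsum ?s UNIV)
      (finite_subsets_at_top UNIV)"
    by (intro tendsto_intros infsum_tendsto coeff_summable)
  then have "((\<lambda>F. (norm (?p F - f))\<^sup>2) \<longlongrightarrow> 0) (finite_subsets_at_top UNIV)"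
    by (rule Lim_transform_eventually[THEN tendsto_eq_rhs])
       (auto simp: rest intro!: eventually_finite_subsets_at_top_weakI)
  then have "((\<lambda>F. sqrt ((norm (?p F - f))\<^sup>2)) \<longlongrightarrow> sqrt 0) (finite_subsets_at_top UNIV)"
    by (rule tendsto_real_sqrt)
  then have "((\<lambda>F. norm (?p F - f)) \<longlongrightarrow> 0) (finite_subsets_at_top UNIV)"
    by (simp only: real_sqrt_zero real_sqrt_abs abs_norm_cancel)
  then have "((\<lambda>F. ?p F - f) \<longlongrightarrow> 0) (finite_subsets_at_top UNIV)"
    by (rule tendsto_norm_zero_cancel)
  then show ?thesis
    unfolding has_sum_def by (rule LIM_zero_cancel)
qed

lemma bounded_linear_scaleC_ell2: "bounded_linear (\<lambda>x :: 'a ell2. c *\<^sub>C x)"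
proof (rule bounded_linear_intro)
  show "norm (c *\<^sub>C x) \<le> norm x * cmod c" for x :: "'a ell2"
  proof (rule power2_le_imp_le)
    show "(norm (c *\<^sub>C x))\<^sup>2 \<le> (norm x * cmod c)\<^sup>2"
      unfolding norm_ell2_sq power_mult_distrib scaleC_ell2.rep_eq norm_mult
      by (subst infsum_cmult_right) (auto intro: coeff_summable)
  qed simp
qed (simp_all add: scaleC_add_right scaleR_eq_scaleC scaleC_scaleC mult.commute)

text \<open>
  The maps are only real-linear, because the lemma is also applied to real inner products; this is
  why they must agree on all complex multiples of the basis vectors.
\<close>

lemma bounded_linear_eqI_basis_vec:
  assumes "bounded_linear S" "bounded_linear T"
    and "\<And>c w. S (c *\<^sub>C \<xi> w) = T (c *\<^sub>C \<xi> w)"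
  shows "S f = T f"
  using has_sum_bounded_linear[OF assms(1) has_sum_basis_expansion[of f]]
    has_sum_bounded_linear[OF assms(2) has_sum_basis_expansion[of f]]
  unfolding assms(3) by (rule has_sum_unique)

section \<open>Commutation with right multiplication\<close>

lift_definition right_creation :: "'n \<Rightarrow> 'n list ell2 \<Rightarrow> 'n list ell2" is
  "\<lambda>j f w. if w \<noteq> [] \<and> last w = j then f (butlast w) else 0"
  subgoal for j f
  proof -
    assume "(\<lambda>x. (cmod (f x))\<^sup>2) summable_on UNIV"
    then have "(\<lambda>w. (cmod (if w \<noteq> [] \<and> last w = j then f (butlast w) else 0))\<^sup>2)
        summable_on range (\<lambda>v. v @ [j])"
      by (subst summable_on_reindex) (auto simp: o_def inj_on_def)
    then show ?thesis
      by (rule summable_on_cong_neutral[THEN iffD1, rotated -1])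
         (auto simp: image_iff split: if_splits intro: append_butlast_last_id[symmetric])
  qed
  done

lemma right_creation_basis_vec: "right_creation j (\<xi> v) = \<xi> (v @ [j])"
  by transfer (auto simp: fun_eq_iff)

lemma right_creation_add:
  "right_creation j (f + g) = right_creation j f + right_creation j g"
  by transfer (auto simp: fun_eq_iff)

lemma right_creation_scaleC: "right_creation j (c *\<^sub>C f) = c *\<^sub>C right_creation j f"
  by transfer (auto simp: fun_eq_iff)

lemma left_creation_right_creation:
  "left_creation i (right_creation j f) = right_creation j (left_creation i f)"
  by transfer (auto simp: fun_eq_iff split: list.splits)

text \<open>
  The commutant of the right creation operators is a WOT-closed unital algebra containing the
  left creation operators, hence contains \<^const>\<open>nc_toeplitz_algebra\<close>.
\<close>

definition right_commutant :: "('n list ell2 \<Rightarrow> 'n list ell2) set" where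
  "right_commutant = {T. bounded_clinear T \<and>
     (\<forall>j f. T (right_creation j f) = right_creation j (T f))}"

lemma topspace_weak_operator_topology:
  "topspace weak_operator_topology = {T :: 'a::complex_inner \<Rightarrow> 'a. bounded_clinear T}"
  unfolding weak_operator_topology_def topology_generated_by_topspace
proof (intro equalityI subsetI)
  fix T :: "'a \<Rightarrow> 'a" assume "T \<in> {T. bounded_clinear T}"
  then have "T \<in> {T. bounded_clinear T \<and> cinner (T 0) 0 \<in> UNIV}" by simp
  then show "T \<in> \<Union> {{T. bounded_clinear T \<and> cinner (T x) y \<in> U} | x y U. open U}"
    using open_UNIV by blast
qed auto

lemma continuous_map_matrix_entry:
  "continuous_map weak_operator_topology euclidean (\<lambda>T. cinner (T x) y)"
  unfolding continuous_map_def
proof (intro conjI allI impI)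
  fix U :: "complex set" assume "openin euclidean U"
  then have "openin weak_operator_topology {T. bounded_clinear T \<and> cinner (T x) y \<in> U}"
    unfolding weak_operator_topology_def
    by (intro topology_generated_by_Basis) auto
  then show "openin weak_operator_topology
      {T \<in> topspace weak_operator_topology. cinner (T x) y \<in> U}"
    by (simp add: topspace_weak_operator_topology)
qed simp

lemma closedin_right_commutant:
  "closedin weak_operator_topology (right_commutant :: ('n list ell2 \<Rightarrow> 'n list ell2) set)"
proof -
  \<comment> \<open>The matrix entry of \<open>right_creation j (T f)\<close> at \<open>w\<close> is one of \<open>T f\<close>, or constantly \<open>0\<close>.\<close>
  let ?E = "\<lambda>(j :: 'n, f, w). {T \<in> topspace weak_operator_topology.
    cinner (T (right_creation j f)) (\<xi> w) =
    (if w \<noteq> [] \<and> last w = j then cinner (T f) (\<xi> (butlast w)) else 0)}"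
  have "right_commutant = (\<Inter>p. ?E p)"
  proof (intro set_eqI)
    fix T :: "'n list ell2 \<Rightarrow> 'n list ell2"
    have "T (right_creation j f) = right_creation j (T f) \<longleftrightarrow>
      (\<forall>w. cinner (T (right_creation j f)) (\<xi> w) =
        (if w \<noteq> [] \<and> last w = j then cinner (T f) (\<xi> (butlast w)) else 0))" for j f
      by (simp add: cinner_basis_vec coeff_inject[symmetric] fun_eq_iff right_creation.rep_eq)
    then show "T \<in> right_commutant \<longleftrightarrow> T \<in> (\<Inter>p. ?E p)"
      by (simp add: right_commutant_def topspace_weak_operator_topology)
  qed
  moreover have "closedin weak_operator_topology (?E p)" for p
  proof (cases p)
    case (fields j f w)
    show ?thesis
      unfolding fields split
      by (rule closedin_continuous_maps_eq[OF Hausdorff_space_euclidean])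
         (auto intro: continuous_map_matrix_entry)
  qed
  ultimately show ?thesis by (metis (no_types, lifting) UNIV_not_empty closedin_INT)
qed

lemma unital_subalgebra_right_commutant:
  "unital_subalgebra (right_commutant :: ('n list ell2 \<Rightarrow> 'n list ell2) set)"
proof -
  have "id \<in> right_commutant"
    by (simp add: right_commutant_def bounded_clinear_def id_def)
  moreover have "(\<lambda>x. S x + T x) \<in> right_commutant" "(\<lambda>x. c *\<^sub>C T x) \<in> right_commutant"
    "S \<circ> T \<in> right_commutant"
    if "S \<in> right_commutant" "T \<in> right_commutant" for S T :: "'n list ell2 \<Rightarrow> 'n list ell2" and c
    using that bounded_linear_add[of S T] bounded_linear_compose[of S T]
      bounded_linear_compose[OF bounded_linear_scaleC_ell2[of c], of T]
    by (simp_all add: right_commutant_def bounded_clinear_def o_def right_creation_add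
        right_creation_scaleC scaleC_add_right scaleC_scaleC mult.commute)
  ultimately show ?thesis
    unfolding unital_subalgebra_def by (auto simp: right_commutant_def)
qed

lemma nc_toeplitz_algebra_commutes_right_creation:
  assumes "L \<in> nc_toeplitz_algebra"
  shows "L (right_creation j f) = right_creation j (L f)"
proof -
  have "left_creation i \<in> right_commutant" for i :: 'a
    using isometry_left_creation[of i]
    by (simp add: right_commutant_def left_creation_right_creation isometry_def)
  then have "range left_creation \<subseteq> (right_commutant :: ('a list ell2 \<Rightarrow> 'a list ell2) set)"
    by blast
  then have "L \<in> right_commutant"
    using assms closedin_right_commutant unital_subalgebra_right_commutant
    unfolding nc_toeplitz_algebra_def by blast
  then show ?thesis by (simp add: right_commutant_def)
qed

section \<open>Matrix entries and the adjoint on basis vectors\<close>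

lemma coeff_image_basis_vec_append:
  assumes "L \<in> nc_toeplitz_algebra"
  shows "coeff (L (\<xi> v)) (u @ v) = coeff (L (\<xi> [])) u"
proof (induction v rule: rev_induct)
  case (snoc j v)
  have "L (\<xi> (v @ [j])) = right_creation j (L (\<xi> v))"
    using nc_toeplitz_algebra_commutes_right_creation[OF assms]
    by (simp flip: right_creation_basis_vec)
  then show ?case
    using snoc by (simp add: right_creation.rep_eq butlast_append flip: append_assoc)
qed simp

lemma coeff_image_basis_vec_not_suffix:
  assumes "L \<in> nc_toeplitz_algebra" "\<nexists>u. w = u @ v"
  shows "coeff (L (\<xi> v)) w = 0"
  using assms(2)
proof (induction v arbitrary: w rule: rev_induct)
  case (snoc j v)
  have "L (\<xi> (v @ [j])) = right_creation j (L (\<xi> v))"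
    using nc_toeplitz_algebra_commutes_right_creation[OF assms(1)]
    by (simp flip: right_creation_basis_vec)
  moreover have "coeff (L (\<xi> v)) (butlast w) = 0" if "w \<noteq> []" "last w = j"
  proof (rule snoc.IH, rule notI)
    assume "\<exists>u. butlast w = u @ v"
    then show False
      using snoc.prems append_butlast_last_id[OF that(1)] that(2) by (metis append_assoc)
  qed
  ultimately show ?case by (simp add: right_creation.rep_eq)
qed simp

text \<open>
  This is \<open>L\<^sup>* \<xi>\<^sub>w\<close>: by the two lemmas above, row \<open>w\<close> of the matrix of \<open>L\<close> is supported on the
  finitely many suffixes of \<open>w\<close>.
\<close>

definition adjoint_basis_vec :: "('n list ell2 \<Rightarrow> 'n list ell2) \<Rightarrow> 'n list \<Rightarrow> 'n list ell2" where
  "adjoint_basis_vec L w =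
     (\<Sum>k\<le>length w. cnj (coeff (L (\<xi> [])) (take k w)) *\<^sub>C \<xi> (drop k w))"

lemma coeff_adjoint_basis_vec:
  assumes "L \<in> nc_toeplitz_algebra"
  shows "coeff (adjoint_basis_vec L w) v = cnj (coeff (L (\<xi> v)) w)"
proof -
  let ?c = "\<lambda>k. cnj (coeff (L (\<xi> [])) (take k w))"
  have sum: "coeff (adjoint_basis_vec L w) v =
      (\<Sum>k\<le>length w. if v = drop k w then ?c k else 0)"
    by (simp add: adjoint_basis_vec_def coeff_sum scaleC_ell2.rep_eq coeff_basis_vec
        if_distrib cong: if_cong)
  show ?thesis
  proof (cases "\<exists>u. w = u @ v")
    case True
    then obtain u where u: "w = u @ v" by blast
    have "v = drop k w \<longleftrightarrow> k = length u" if "k \<le> length w" for k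
    proof
      assume "v = drop k w"
      then have "length v = length w - k" by simp
      then show "k = length u" using that u by simp
    qed (simp add: u)
    then have "coeff (adjoint_basis_vec L w) v =
        (\<Sum>k\<le>length w. if k = length u then ?c k else 0)"
      unfolding sum by (intro sum.cong) auto
    then show ?thesis
      using coeff_image_basis_vec_append[OF assms, of v u] by (simp add: u)
  next
    case False
    then have "v \<noteq> drop k w" for k
      by (metis append_take_drop_id)
    then show ?thesis
      unfolding sum using coeff_image_basis_vec_not_suffix[OF assms False] by simp
  qed
qed

lemma inner_adjoint_basis_vec:
  assumes "L \<in> nc_toeplitz_algebra" "bounded_clinear L"
  shows "inner (adjoint_basis_vec L w) h = inner (\<xi> w) (L h)"
proof (rule bounded_linear_eqI_basis_vec[where S = "inner (adjoint_basis_vec L w)"])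
  have L: "bounded_linear L" and sc: "\<And>c x. L (c *\<^sub>C x) = c *\<^sub>C L x"
    using assms(2) by (auto simp: bounded_clinear_def)
  show "bounded_linear (inner (adjoint_basis_vec L w))"
    by (rule bounded_linear_inner_right)
  show "bounded_linear (\<lambda>h. inner (\<xi> w) (L h))"
    by (rule bounded_linear_compose[OF bounded_linear_inner_right L])
  show "inner (adjoint_basis_vec L w) (c *\<^sub>C \<xi> v) = inner (\<xi> w) (L (c *\<^sub>C \<xi> v))" for c v
    by (simp add: inner_commute[of "\<xi> w"] inner_basis_vec sc scaleC_ell2.rep_eq
        inner_eq_Re_cinner[of "adjoint_basis_vec L w"] cinner_scaleC_right cinner_basis_vec
        coeff_adjoint_basis_vec[OF assms(1)])
qed

lemma norm_adjoint_basis_vec: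
  assumes "L \<in> nc_toeplitz_algebra"
  shows "(norm (adjoint_basis_vec L w))\<^sup>2 =
    (\<Sum>k\<le>length w. (cmod (coeff (L (\<xi> [])) (take k w)))\<^sup>2)"
proof -
  let ?g = "adjoint_basis_vec L w"
  have g: "cnj (coeff ?g (drop k w)) = coeff (L (\<xi> [])) (take k w)" for k
    using coeff_image_basis_vec_append[OF assms, of "drop k w" "take k w"]
    by (simp add: coeff_adjoint_basis_vec[OF assms])
  have "(norm ?g)\<^sup>2 = (\<Sum>k\<le>length w.
      inner (cnj (coeff (L (\<xi> [])) (take k w)) *\<^sub>C \<xi> (drop k w)) ?g)"
    unfolding power2_norm_eq_inner
    by (subst (1) adjoint_basis_vec_def) (rule inner_sum_left)
  also have "\<dots> = (\<Sum>k\<le>length w. (cmod (coeff (L (\<xi> [])) (take k w)))\<^sup>2)"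
  proof (rule sum.cong[OF refl])
    fix k
    let ?c = "coeff (L (\<xi> [])) (take k w)"
    have "cinner (cnj ?c *\<^sub>C \<xi> (drop k w)) ?g = cnj ?c * cnj (coeff ?g (drop k w))"
      by (simp add: cinner_scaleC_left cinner_commute[of "\<xi> (drop k w)"] cinner_basis_vec)
    then show "inner (cnj ?c *\<^sub>C \<xi> (drop k w)) ?g = (cmod ?c)\<^sup>2"
      by (simp only: inner_eq_Re_cinner g mult.commute[of "cnj ?c"]
          complex_norm_square[symmetric] Re_complex_of_real)
  qed
  finally show ?thesis .
qed

section \<open>Finite wandering dimension forces a scalar\<close>

text \<open>
  The prefixes of \<open>a\<^sup>m\<close> are the powers \<open>a\<^sup>k\<close> with \<open>k \<le> m\<close>, so the partial sums differ from \<open>1\<close> by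
  the squared norms of the projections of the orthonormal vectors \<open>J \<xi>\<^bsub>a\<^sup>m\<^esub>\<close> to a
  finite-dimensional space.
\<close>

lemma finite_wandering_dim_imp_path_sum_1:
  assumes L: "L \<in> nc_toeplitz_algebra" "bounded_clinear L"
    and dil: "minimal_isometric_dilation J L V"
    and fin: "edim (UNIV \<ominus> range V) \<noteq> \<infinity>"
  shows "(\<lambda>m. \<Sum>k\<le>m. (cmod (coeff (L (\<xi> [])) (replicate k a)))\<^sup>2) \<longlonglongrightarrow> 1"
proof -
  let ?W = "UNIV \<ominus> range V"
  let ?w = "\<lambda>m. replicate m a"
  let ?e = "\<lambda>m. J (\<xi> (?w m)) - V (J (adjoint_basis_vec L (?w m)))"
  obtain B where B: "finite B" "?W \<subseteq> span B"
    using finite_edim_real_span[OF fin] by blast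
  have J: "isometry J"
    using dil by (simp add: minimal_isometric_dilation_def)
  note defect = defect_vector[OF dil inner_adjoint_basis_vec[OF L]]
  have "(\<lambda>m. (norm (?e m))\<^sup>2) \<longlonglongrightarrow> 0"
  proof (rule finite_dim_projection_tendsto_0[OF B])
    show "subspace ?W"
      by (rule subspaceI)
        (auto simp: orth_minus_def cinner_add_left scaleR_eq_scaleC cinner_scaleC_left
          intro: cinner_eq_0I)
    show "inner (J (\<xi> (?w m))) (J (\<xi> (?w n))) = (if m = n then 1 else 0)" for m n
      by (auto simp: isometry_inner[OF J] inner_basis_vec coeff_basis_vec replicate_eq_replicate)
    show "?e m \<in> ?W" for m
      by (rule defect(1))
    show "inner (?e m) y = inner (J (\<xi> (?w m))) y" if "y \<in> ?W" for m y
    proof -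
      have "inner y (V z) = 0" for z
        using that by (simp add: orth_minus_def inner_eq_Re_cinner)
      then show ?thesis by (simp add: inner_diff_right inner_commute[of _ y])
    qed
  qed
  moreover have "(norm (?e m))\<^sup>2 =
      1 - (\<Sum>k\<le>m. (cmod (coeff (L (\<xi> [])) (replicate k a)))\<^sup>2)" for m
  proof -
    have "(norm (\<xi> (?w m)))\<^sup>2 = 1"
      by (simp add: power2_norm_eq_inner inner_basis_vec coeff_basis_vec)
    then show ?thesis
      unfolding defect(2) norm_adjoint_basis_vec[OF L(1)]
      by (auto intro!: sum.cong simp: min_def)
  qed
  ultimately have "(\<lambda>m. 1 - (\<Sum>k\<le>m. (cmod (coeff (L (\<xi> [])) (replicate k a)))\<^sup>2)) \<longlonglongrightarrow> 0"
    by simp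
  from tendsto_diff[OF tendsto_const[of 1] this] show ?thesis by simp
qed

lemma nc_toeplitz_algebra_scalar_unitary:
  assumes L: "L \<in> nc_toeplitz_algebra" "bounded_clinear L"
    and unit: "cmod (coeff (L (\<xi> [])) []) = 1"
    and zero: "\<And>u. u \<noteq> [] \<Longrightarrow> coeff (L (\<xi> [])) u = 0"
  shows "unitary L"
proof -
  define c where "c = coeff (L (\<xi> [])) []"
  have blL: "bounded_linear L" and sc: "\<And>d x. L (d *\<^sub>C x) = d *\<^sub>C L x"
    using L(2) by (auto simp: bounded_clinear_def)
  have "coeff (L (\<xi> v)) w = coeff (c *\<^sub>C \<xi> v) w" for v w
  proof (cases "\<exists>u. w = u @ v")
    case True
    then obtain u where u: "w = u @ v" by blast
    have "coeff (L (\<xi> v)) w = coeff (L (\<xi> [])) u"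
      unfolding u by (rule coeff_image_basis_vec_append[OF L(1)])
    then show ?thesis
      using zero[of u]
      by (cases "u = []") (simp_all add: u scaleC_ell2.rep_eq coeff_basis_vec c_def)
  next
    case False
    then have "w \<noteq> v" by auto
    then show ?thesis
      by (simp add: coeff_image_basis_vec_not_suffix[OF L(1) False] scaleC_ell2.rep_eq
          coeff_basis_vec)
  qed
  then have basis: "L (\<xi> v) = c *\<^sub>C \<xi> v" for v
    by (simp add: coeff_inject[symmetric] fun_eq_iff)
  have Lc: "L h = c *\<^sub>C h" for h
    by (rule bounded_linear_eqI_basis_vec[OF blL bounded_linear_scaleC_ell2])
       (simp add: sc basis scaleC_scaleC mult.commute)
  have c1: "cmod c = 1" and nz: "c \<noteq> 0"
    using unit by (auto simp: c_def)
  have "norm (L h) = norm h" for h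
  proof -
    have "(norm (L h))\<^sup>2 = (norm h)\<^sup>2"
      unfolding Lc norm_ell2_sq scaleC_ell2.rep_eq norm_mult by (simp add: c1)
    then show ?thesis by (simp add: power2_eq_iff_nonneg)
  qed
  moreover have "surj L"
    unfolding surj_def Lc
    using nz by (metis scaleC_scaleC scaleC_one right_inverse)
  ultimately show ?thesis
    using L(2) by (simp add: unitary_def isometry_def)
qed

theorem theorem1p10:
  fixes L :: "'n::finite list ell2 \<Rightarrow> 'n list ell2"
    and J :: "'n list ell2 \<Rightarrow> 'k::chilbert_space"
    and V :: "'k \<Rightarrow> 'k"
  assumes "CARD('n) \<ge> 2"
    and "L \<in> nc_toeplitz_algebra" "contraction L" "\<not> unitary L"
    and "minimal_isometric_dilation J L V"
  shows "edim (UNIV \<ominus> range V) = \<infinity>"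
proof (rule ccontr)
  assume fin: "edim (UNIV \<ominus> range V) \<noteq> \<infinity>"
  have L: "L \<in> nc_toeplitz_algebra" "bounded_clinear L"
    using assms by (auto simp: contraction_def)
  have "\<not> is_singleton (UNIV :: 'n set)"
    using assms(1) by (simp add: is_singleton_altdef)
  then obtain a b :: 'n where "a \<noteq> b"
    by (metis UNIV_I UNIV_eq_I is_singletonI singleton_iff)
  let ?t = "\<lambda>w. (cmod (coeff (L (\<xi> [])) w))\<^sup>2"
  have "norm (L (\<xi> [])) \<le> onorm L * norm (\<xi> [] :: 'n list ell2)"
    using L(2) by (intro onorm) (simp add: bounded_clinear_def)
  also have "norm (\<xi> [] :: 'n list ell2) = 1"
    by (simp add: norm_eq_sqrt_inner inner_basis_vec coeff_basis_vec)
  finally have "norm (L (\<xi> [])) \<le> 1"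
    using assms(3) by (simp add: contraction_def)
  then have "(norm (L (\<xi> [])))\<^sup>2 \<le> 1"
    by (simp add: power_le_one)
  then have total: "sum ?t F \<le> 1" if "finite F" for F
    using sum_coeff_le_norm[OF that, of "L (\<xi> [])"] by linarith
  have "(\<Sum>k\<le>m. ?t (replicate k a)) + (\<Sum>k\<le>m. ?t (replicate k b)) \<le> 1 + ?t []" for m
  proof -
    let ?A = "(\<lambda>k. replicate k a) ` {..m}" and ?B = "(\<lambda>k. replicate k b) ` {..m}"
    have inj: "inj_on (\<lambda>k. replicate k x) {..m}" for x :: 'n
      by (auto simp: inj_on_def replicate_eq_replicate)
    have "?A \<inter> ?B = {[]}"
      using \<open>a \<noteq> b\<close> by (auto simp: replicate_eq_replicate image_iff intro: bexI[of _ 0])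
    then have "sum ?t ?A + sum ?t ?B = sum ?t (?A \<union> ?B) + ?t []"
      using sum.union_inter[of ?A ?B ?t] by simp
    also have "\<dots> \<le> 1 + ?t []"
      using total[of "?A \<union> ?B"] by simp
    finally show ?thesis by (simp add: sum.reindex[OF inj])
  qed
  \<comment> \<open>Let \<open>m\<close> tend to infinity: each of the two sums tends to \<open>1\<close>.\<close>
  then have "1 + 1 \<le> 1 + ?t []"
    by (intro LIMSEQ_le[OF tendsto_add[OF
          finite_wandering_dim_imp_path_sum_1[OF L assms(5) fin, of a]
          finite_wandering_dim_imp_path_sum_1[OF L assms(5) fin, of b]] tendsto_const]) blast
  then have one: "?t [] = 1"
    using total[of "{[]}"] by simp
  have "coeff (L (\<xi> [])) u = 0" if "u \<noteq> []" for u
    using total[of "{[], u}"] that one by simp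
  moreover have "cmod (coeff (L (\<xi> [])) []) = 1"
    using one abs_square_eq_1[of "cmod (coeff (L (\<xi> [])) [])"] by simp
  ultimately have "unitary L"
    by (intro nc_toeplitz_algebra_scalar_unitary L) auto
  with assms(4) show False by contradiction
qed

end
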